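(* The Optimal Halpern Method (OHM) $$y_{k+1}=\frac1{k+2}y_0+\frac{k+1}{k+2}Ty_k,\qquad k=0,1,2,\dots$$ is the only anytime optimal algorithm among algorithms of the form $$y_{k+1}=y_k-\sum_{j=0}^kh_{k+1,j+1}(y_j-Ty_j),\qquad k=0,1,2,\dots,$$ with predetermined real coefficients $h_{k+1,j+1}$ ($k\ge0$, $0\le j\le k$). More generally, for any integer $N\ge1$, if an algorithm of this form is anytime-beyond-$N$-steps optimal, then its update takes the form $$y_{k+1}=\frac1{k+2}y_0+\frac{k+1}{k+2}Ty_k\qquad\text{for all }k=N-1,N,N+1,\dots.$$
   Context: $T:\mathbb{R}^d\to\mathbb{R}^d$ is nonexpansive if $\|Tx-Ty\|\le\|x-y\|$ for all $x,y$ (Euclidean norm). The coefficients $h_{k+1,j+1}$ are fixed in advance and do not depend on $T$, $y_0$ or $d$. An algorithm $y_{k+1}=y_k-\sum_{j=0}^kh_{k+1,j+1}(y_j-Ty_j)$ ($k=0,1,2,\dots$) is called anytime optimal if $$\|y_k-Ty_k\|^2\le\frac{4\|y_0-y_\star\|^2}{(k+1)^2}$$ holds for all $k=0,1,2,\dots$, for every $d\ge 1$, every nonexpansive $T:\mathbb{R}^d\to\mathbb{R}^d$ with a fixed point, every fixed point $y_\star$ of $T$ and every initial point $y_0\in\mathbb{R}^d$. It is called anytime-beyond-$N$-steps optimal if this inequality holds (for all such $d,T,y_\star,y_0$) for all $k=N-1,N,N+1,\dots$. *)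

theory Defs
  imports "HOL-Analysis.Analysis"
begin

text \<open>The dimension has to be quantified inside the hypotheses, so the space of dimension d
  is the carrier \<open>topspace (Euclidean_space d)\<close>: the sequences that vanish
  at all indices from d on. Vector operations are written out componentwise.\<close>

definition eucl_dist :: "nat \<Rightarrow> (nat \<Rightarrow> real) \<Rightarrow> (nat \<Rightarrow> real) \<Rightarrow> real" where
  "eucl_dist d x y = L2_set (\<lambda>i. x i - y i) {..<d}"

definition nonexpansive :: "nat \<Rightarrow> ((nat \<Rightarrow> real) \<Rightarrow> (nat \<Rightarrow> real)) \<Rightarrow> bool" where
  "nonexpansive d T \<longleftrightarrow>
     T \<in> topspace (Euclidean_space d) \<rightarrow> topspace (Euclidean_space d) \<and>
     (\<forall>x\<in>topspace (Euclidean_space d). \<forall>y\<in>topspace (Euclidean_space d).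
        eucl_dist d (T x) (T y) \<le> eucl_dist d x y)"

text \<open>Only the coefficients \<open>h (k + 1) (j + 1)\<close> with \<open>j \<le> k\<close> matter; the remaining values of
  \<open>h\<close> are never used.\<close>

fun iterates ::
  "(nat \<Rightarrow> nat \<Rightarrow> real) \<Rightarrow> ((nat \<Rightarrow> real) \<Rightarrow> (nat \<Rightarrow> real)) \<Rightarrow> (nat \<Rightarrow> real) \<Rightarrow> nat \<Rightarrow> (nat \<Rightarrow> real)"
where
  "iterates h T y0 0 = y0"
| "iterates h T y0 (Suc k) =
     (\<lambda>i. iterates h T y0 k i -
        (\<Sum>j\<le>k. h (k + 1) (j + 1) * (iterates h T y0 j i - T (iterates h T y0 j) i)))"

definition halpern_step ::
  "((nat \<Rightarrow> real) \<Rightarrow> (nat \<Rightarrow> real)) \<Rightarrow> (nat \<Rightarrow> real) \<Rightarrow> nat \<Rightarrow> (nat \<Rightarrow> real) \<Rightarrow> (nat \<Rightarrow> real)"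
where
  "halpern_step T y0 k y = (\<lambda>i. 1 / (real k + 2) * y0 i + (real k + 1) / (real k + 2) * T y i)"

fun OHM :: "((nat \<Rightarrow> real) \<Rightarrow> (nat \<Rightarrow> real)) \<Rightarrow> (nat \<Rightarrow> real) \<Rightarrow> nat \<Rightarrow> (nat \<Rightarrow> real)" where
  "OHM T y0 0 = y0"
| "OHM T y0 (Suc k) = halpern_step T y0 k (OHM T y0 k)"

definition optimal_at :: "(nat \<Rightarrow> nat \<Rightarrow> real) \<Rightarrow> nat \<Rightarrow> bool" where
  "optimal_at h k \<longleftrightarrow>
     (\<forall>d\<ge>1. \<forall>T. nonexpansive d T \<longrightarrow>
       (\<forall>ystar\<in>topspace (Euclidean_space d). T ystar = ystar \<longrightarrow>
         (\<forall>y0\<in>topspace (Euclidean_space d).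
           (eucl_dist d (iterates h T y0 k) (T (iterates h T y0 k)))\<^sup>2
             \<le> 4 * (eucl_dist d y0 ystar)\<^sup>2 / (real k + 1)\<^sup>2)))"

definition anytime_optimal :: "(nat \<Rightarrow> nat \<Rightarrow> real) \<Rightarrow> bool" where
  "anytime_optimal h \<longleftrightarrow> (\<forall>k. optimal_at h k)"

definition anytime_beyond_optimal :: "nat \<Rightarrow> (nat \<Rightarrow> nat \<Rightarrow> real) \<Rightarrow> bool" where
  "anytime_beyond_optimal N h \<longleftrightarrow> (\<forall>k\<ge>N - 1. optimal_at h k)"

end

theory Submission
  imports Defs
begin

text \<open>For a linear operator the iterates are \<open>p\<^sub>k(T) y\<^sub>0\<close> with polynomials \<open>p\<^sub>k\<close> satisfying
  \<open>p\<^sub>k(1) = 1\<close> and \<open>deg p\<^sub>k \<le> k\<close>. Let \<open>n = k + 1\<close>, let \<open>T\<close> be the negacyclic shift of \<open>n\<close>-space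
  (\<open>T\<^sup>n = -1\<close>), and let \<open>y\<^sub>0\<close> be the all-ones vector. As \<open>(1 - T) y\<^sub>0 = 2 e\<^sub>0\<close>, the residual at step \<open>k\<close>
  is twice the coefficient vector of \<open>p\<^sub>k\<close>. Optimality at step \<open>k\<close> thus bounds the sum of squares of
  the coefficients by \<open>1/n\<close>, and since they add up to \<open>1\<close>, all of them equal \<open>1/n\<close>. In particular
  the leading coefficients of \<open>p\<^sub>0, \<dots>, p\<^sub>k\<close> do not vanish, so these polynomials are linearly
  independent, and the step coefficients can be read off from \<open>p\<^sub>k\<^sub>+\<^sub>1 = (1 + (k + 1) z p\<^sub>k) / (k + 2)\<close>.\<close>

section \<open>Optimality of the Halpern method\<close>

lemma eucl_dist_power2: "(eucl_dist d x y)\<^sup>2 = (\<Sum>i<d. (x i - y i)\<^sup>2)"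
  by (simp add: eucl_dist_def L2_set_def sum_nonneg)

lemma halpern_step_eq_iff:
  "z = halpern_step T y0 k y i \<longleftrightarrow> (real k + 2) * z = y0 i + (real k + 1) * T y i"
proof -
  have "real k + 2 \<noteq> 0" by linarith
  moreover have "halpern_step T y0 k y i = (y0 i + (real k + 1) * T y i) / (real k + 2)"
    by (simp add: halpern_step_def add_divide_distrib[of "y0 i"])
  ultimately show ?thesis
    by (metis nonzero_eq_divide_eq mult.commute)
qed

lemma iterates_in_space:
  assumes "nonexpansive d T" and "y0 \<in> topspace (Euclidean_space d)"
  shows "iterates h T y0 k \<in> topspace (Euclidean_space d)"
proof (induction k rule: less_induct)
  case (less k)
  have T: "T x \<in> topspace (Euclidean_space d)" if "x \<in> topspace (Euclidean_space d)" for x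
    using assms(1) that by (auto simp: nonexpansive_def)
  show ?case
  proof (cases k)
    case 0
    then show ?thesis using assms by simp
  next
    case (Suc m)
    have "iterates h T y0 j i = 0" "T (iterates h T y0 j) i = 0" if "j \<le> m" "d \<le> i" for i j
      using less[of j] T[OF less[of j]] that Suc by (auto simp: topspace_Euclidean_space)
    then show ?thesis
      using Suc by (simp add: topspace_Euclidean_space)
  qed
qed

text \<open>Cocoercivity of the identity minus \<open>T\<close>: with a = x - y and b the difference
  of the residuals, a - b = T x - T y, so twice the inner product of a and b, minus |b|^2, equals
  |a|^2 - |a - b|^2.\<close>

lemma residual_inner_ge:
  assumes "nonexpansive d T" and "x \<in> topspace (Euclidean_space d)"
    and "y \<in> topspace (Euclidean_space d)"
  shows "(\<Sum>i<d. ((x i - T x i) - (y i - T y i))\<^sup>2)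
          \<le> 2 * (\<Sum>i<d. (x i - y i) * ((x i - T x i) - (y i - T y i)))"
proof -
  have "(eucl_dist d (T x) (T y))\<^sup>2 \<le> (eucl_dist d x y)\<^sup>2"
    using assms by (intro power_mono) (auto simp: nonexpansive_def eucl_dist_def)
  then have "(\<Sum>i<d. (T x i - T y i)\<^sup>2) \<le> (\<Sum>i<d. (x i - y i)\<^sup>2)"
    by (simp add: eucl_dist_power2)
  moreover have "2 * (\<Sum>i<d. (x i - y i) * ((x i - T x i) - (y i - T y i)))
        - (\<Sum>i<d. ((x i - T x i) - (y i - T y i))\<^sup>2)
      = (\<Sum>i<d. (x i - y i)\<^sup>2) - (\<Sum>i<d. (T x i - T y i)\<^sup>2)"
    unfolding sum_distrib_left sum_subtractf[symmetric]
    by (intro sum.cong refl) (simp add: power2_eq_square algebra_simps)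
  ultimately show ?thesis by linarith
qed

text \<open>The Halpern step with \<open>y0\<close> eliminated in favour of the residuals. The
  indices are the shifted ones: row \<open>k\<close> produces iterate \<open>k\<close>, and column
  \<open>j\<close> weights the residual of iterate \<open>j - 1\<close>.\<close>

definition halpern_coeff :: "nat \<Rightarrow> nat \<Rightarrow> real" where
  "halpern_coeff k j =
     (if j = k then real k / (real k + 1) else - (real j / (real k * (real k + 1))))"

text \<open>After scaling by \<open>k + 1\<close>, the weights \<open>j + 1\<close> no longer depend
  on \<open>k\<close>, so each step only appends one term. This lets the stored residuals stand for
  \<open>y0\<close>.\<close>

lemma iterates_halpern_coeff_minus_start:
  "(real k + 1) * (iterates halpern_coeff T y0 k i - y0 i)
     = - (\<Sum>j<k. (real j + 1) * (iterates halpern_coeff T y0 j i - T (iterates halpern_coeff T y0 j) i))"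
proof (induction k)
  case 0
  show ?case by simp
next
  case (Suc k)
  let ?y = "iterates halpern_coeff T y0"
  let ?g = "\<lambda>j. ?y j i - T (?y j) i"
  define A where "A = (\<Sum>j<k. (real j + 1) * ?g j)"
  have "(\<Sum>j<k. halpern_coeff (k + 1) (j + 1) * ?g j)
      = (\<Sum>j<k. - (1 / ((real k + 1) * (real k + 2))) * ((real j + 1) * ?g j))"
  proof (intro sum.cong refl)
    fix j
    assume "j \<in> {..<k}"
    then have "halpern_coeff (k + 1) (j + 1) = - (1 / ((real k + 1) * (real k + 2))) * (real j + 1)"
      by (simp add: halpern_coeff_def add.commute)
    then show "halpern_coeff (k + 1) (j + 1) * ?g j
        = - (1 / ((real k + 1) * (real k + 2))) * ((real j + 1) * ?g j)"
      by (simp only: mult.assoc)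
  qed
  also have "\<dots> = - A / ((real k + 1) * (real k + 2))"
    unfolding sum_distrib_left[symmetric] A_def by simp
  finally have "?y (Suc k) i
      = ?y k i + A / ((real k + 1) * (real k + 2)) - (real k + 1) / (real k + 2) * ?g k"
    by (simp add: lessThan_Suc_atMost[symmetric]) (simp add: halpern_coeff_def add.commute)
  \<comment> \<open>The induction hypothesis turns the whole history \<open>A\<close> into a
    multiple of the displacement from \<open>y0\<close>.\<close>
  moreover have "A / ((real k + 1) * (real k + 2)) = - (?y k i - y0 i) / (real k + 2)"
  proof -
    have "real k + 1 \<noteq> 0"
      by linarith
    moreover have "A = (real k + 1) * - (?y k i - y0 i)"
      by (simp only: A_def Suc minus_mult_right[symmetric] minus_minus)
    ultimately show ?thesis
      by (metis mult_divide_mult_cancel_left)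
  qed
  ultimately have "?y (Suc k) i - y0 i
      = (?y k i - y0 i) - ((?y k i - y0 i) + (real k + 1) * ?g k) / (real k + 2)"
    by (simp only: add_divide_distrib[of "?y k i - y0 i"] minus_divide_left[symmetric]
        times_divide_eq_left)
  moreover have "real k + 2 \<noteq> 0"
    by linarith
  ultimately have "(real k + 2) * (?y (Suc k) i - y0 i)
      = (real k + 2) * (?y k i - y0 i) - ((?y k i - y0 i) + (real k + 1) * ?g k)"
    by (simp only: right_diff_distrib[of _ "?y k i - y0 i"] nonzero_mult_div_cancel_left
        times_divide_eq_right simp_thms)
  also have "\<dots> = - A - (real k + 1) * ?g k"
    using Suc unfolding A_def by (simp add: algebra_simps)
  finally show ?case
    by (simp add: A_def algebra_simps)
qed

text \<open>Subtracting the closed form at \<open>k\<close> from the one at \<open>Suc k\<close>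
  cancels every residual but the newest.\<close>

lemma iterates_halpern_coeff_Suc:
  "iterates halpern_coeff T y0 (Suc k) = halpern_step T y0 k (iterates halpern_coeff T y0 k)"
proof
  fix i
  let ?y = "iterates halpern_coeff T y0"
  have "(real k + 2) * (?y (Suc k) i - y0 i)
      = (real k + 1) * (?y k i - y0 i) - (real k + 1) * (?y k i - T (?y k) i)"
    using iterates_halpern_coeff_minus_start[of "Suc k" T y0 i]
      iterates_halpern_coeff_minus_start[of k T y0 i]
    by (simp add: algebra_simps del: iterates.simps)
  then have "(real k + 2) * ?y (Suc k) i = y0 i + (real k + 1) * T (?y k) i"
    by (simp add: algebra_simps del: iterates.simps)
  then show "?y (Suc k) i = halpern_step T y0 k (?y k) i"
    by (simp only: halpern_step_eq_iff)
qed

lemma iterates_halpern_coeff: "iterates halpern_coeff T y0 k = OHM T y0 k"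
  by (induction k) (simp_all only: iterates_halpern_coeff_Suc OHM.simps iterates.simps(1))

text \<open>A Lyapunov argument: the potential \<open>V\<close> vanishes at 0, and
  \<open>(k + 1) * V k\<close> never increases, because its decrease is
  \<open>(k + 1) * (k + 2)\<close> times the cocoercivity gap between consecutive iterates.\<close>

lemma OHM_potential_nonpos:
  fixes T y0
  defines "g \<equiv> \<lambda>k i. OHM T y0 k i - T (OHM T y0 k) i"
  assumes ne: "nonexpansive d T" and y0: "y0 \<in> topspace (Euclidean_space d)"
  shows "real k * (\<Sum>i<d. (g k i)\<^sup>2) + 2 * (\<Sum>i<d. g k i * (OHM T y0 k i - y0 i)) \<le> 0"
proof (induction k)
  case 0
  show ?case by simp
next
  case (Suc k)
  define V where "V j = real j * (\<Sum>i<d. (g j i)\<^sup>2)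
      + 2 * (\<Sum>i<d. g j i * (OHM T y0 j i - y0 i))" for j
  have space: "OHM T y0 j \<in> topspace (Euclidean_space d)" for j
    using iterates_in_space[OF ne y0, of halpern_coeff j] by (simp add: iterates_halpern_coeff)
  have ge: "0 \<le> 2 * (\<Sum>i<d. (OHM T y0 (Suc k) i - OHM T y0 k i) * (g (Suc k) i - g k i))
      - (\<Sum>i<d. (g (Suc k) i - g k i)\<^sup>2)" (is "0 \<le> ?R")
    using residual_inner_ge[OF ne space space, of "Suc k" k] unfolding g_def by linarith
  \<comment> \<open>One coordinate of the decrease: a is \<open>k\<close>, G and H are the old and
    new residual, D and E the old and new displacement from \<open>y0\<close>. The two sides differ
    by a multiple of the defect of the step equation.\<close>
  have step: "(a + 1) * (a * G\<^sup>2 + 2 * (G * D)) - (a + 2) * ((a + 1) * H\<^sup>2 + 2 * (H * E))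
      = (a + 1) * (a + 2) * (2 * ((E - D) * (H - G)) - (H - G)\<^sup>2)"
    if "(a + 2) * E = (a + 1) * D - (a + 1) * G" for a D E G H :: real
  proof -
    have "(a + 1) * (a * G\<^sup>2 + 2 * (G * D)) - (a + 2) * ((a + 1) * H\<^sup>2 + 2 * (H * E))
        - (a + 1) * (a + 2) * (2 * ((E - D) * (H - G)) - (H - G)\<^sup>2)
        = 2 * ((a + 1) * (G - H) - H) * ((a + 2) * E - ((a + 1) * D - (a + 1) * G))"
      by (simp add: power2_eq_square algebra_simps)
    then show ?thesis using that by simp
  qed
  have pointwise: "(real k + 1) * (real k * (g k i)\<^sup>2 + 2 * (g k i * (OHM T y0 k i - y0 i)))
      - (real k + 2) * ((real k + 1) * (g (Suc k) i)\<^sup>2 + 2 * (g (Suc k) i * (OHM T y0 (Suc k) i - y0 i)))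
      = (real k + 1) * (real k + 2) * (2 * ((OHM T y0 (Suc k) i - OHM T y0 k i) * (g (Suc k) i - g k i))
        - (g (Suc k) i - g k i)\<^sup>2)" for i
  proof -
    have "(real k + 2) * OHM T y0 (Suc k) i = y0 i + (real k + 1) * T (OHM T y0 k) i"
      by (simp only: halpern_step_eq_iff[symmetric] OHM.simps)
    then have "(real k + 2) * (OHM T y0 (Suc k) i - y0 i)
        = (real k + 1) * (OHM T y0 k i - y0 i) - (real k + 1) * g k i"
      by (simp add: g_def algebra_simps del: OHM.simps)
    from step[OF this, of "g (Suc k) i"] show ?thesis
      by (simp del: OHM.simps)
  qed
  have "(real k + 1) * V k - (real k + 2) * V (Suc k) = (real k + 1) * (real k + 2) * ?R"
  proof -
    have "V j = (\<Sum>i<d. real j * (g j i)\<^sup>2 + 2 * (g j i * (OHM T y0 j i - y0 i)))" for j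
      by (simp add: V_def sum.distrib sum_distrib_left)
    then have "(real k + 1) * V k - (real k + 2) * V (Suc k)
        = (\<Sum>i<d. (real k + 1) * (real k * (g k i)\<^sup>2 + 2 * (g k i * (OHM T y0 k i - y0 i)))
      - (real k + 2) * ((real k + 1) * (g (Suc k) i)\<^sup>2 + 2 * (g (Suc k) i * (OHM T y0 (Suc k) i - y0 i))))"
      by (simp only: sum_subtractf sum_distrib_left of_nat_Suc add.commute)
    also have "\<dots> = (real k + 1) * (real k + 2) * ?R"
      by (simp only: pointwise sum_subtractf sum_distrib_left[symmetric])
    finally show ?thesis .
  qed
  moreover have "0 \<le> (real k + 1) * (real k + 2) * ?R"
    using ge by (intro mult_nonneg_nonneg) auto
  ultimately have "(real k + 2) * V (Suc k) \<le> (real k + 1) * V k"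
    by linarith
  also have "\<dots> \<le> 0"
    using Suc by (simp add: V_def mult_le_0_iff)
  finally show ?case
    by (simp add: V_def mult_le_0_iff)
qed

text \<open>Adding cocoercivity against \<open>ystar\<close> to the potential bound replaces the
  unknown \<open>y\<close> by \<open>y0 - ystar\<close> in the inner product; Cauchy-Schwarz then
  gives the rate.\<close>

lemma OHM_rate:
  assumes ne: "nonexpansive d T" and star: "ystar \<in> topspace (Euclidean_space d)" "T ystar = ystar"
    and y0: "y0 \<in> topspace (Euclidean_space d)"
  shows "(eucl_dist d (OHM T y0 k) (T (OHM T y0 k)))\<^sup>2
          \<le> 4 * (eucl_dist d y0 ystar)\<^sup>2 / (real k + 1)\<^sup>2"
proof -
  define y where "y = OHM T y0 k"
  define g where "g i = y i - T y i" for i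
  define G where "G = (\<Sum>i<d. (g i)\<^sup>2)"
  have y: "y \<in> topspace (Euclidean_space d)"
    using iterates_in_space[OF ne y0, of halpern_coeff k] by (simp add: iterates_halpern_coeff y_def)
  have 1: "real k * G + 2 * (\<Sum>i<d. g i * (y i - y0 i)) \<le> 0"
    using OHM_potential_nonpos[OF ne y0, of k] by (simp add: g_def y_def G_def)
  have 2: "G \<le> 2 * (\<Sum>i<d. g i * (y i - ystar i))"
    using residual_inner_ge[OF ne y star(1)] star(2) by (simp add: g_def G_def mult.commute)
  have 3: "(\<Sum>i<d. g i * (y i - ystar i)) - (\<Sum>i<d. g i * (y i - y0 i))
      = (\<Sum>i<d. g i * (y0 i - ystar i))"
    unfolding sum_subtractf[symmetric] by (intro sum.cong refl) (simp add: algebra_simps)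
  have 4: "(real k + 1) * G \<le> 2 * (\<Sum>i<d. g i * (y0 i - ystar i))"
    using 1 2 3 by (simp add: algebra_simps)
  \<comment> \<open>Cauchy-Schwarz in the form of a square: fact \<open>4\<close> bounds the cross
    term by twice the first square, with the opposite sign.\<close>
  have "0 \<le> (\<Sum>i<d. ((real k + 1) * g i - 2 * (y0 i - ystar i))\<^sup>2)"
    by (intro sum_nonneg) simp
  also have "\<dots> = (\<Sum>i<d. (real k + 1)\<^sup>2 * (g i)\<^sup>2 + 4 * (y0 i - ystar i)\<^sup>2
      - (2 * (real k + 1)) * (2 * (g i * (y0 i - ystar i))))"
    by (intro sum.cong refl) (simp add: power2_eq_square algebra_simps)
  also have "\<dots> = (real k + 1)\<^sup>2 * G + 4 * (\<Sum>i<d. (y0 i - ystar i)\<^sup>2)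
      - (2 * (real k + 1)) * (2 * (\<Sum>i<d. g i * (y0 i - ystar i)))"
    unfolding G_def by (simp only: sum_subtractf sum.distrib sum_distrib_left)
  also have "\<dots> \<le> (real k + 1)\<^sup>2 * G + 4 * (\<Sum>i<d. (y0 i - ystar i)\<^sup>2)
      - (2 * (real k + 1)) * ((real k + 1) * G)"
    using mult_left_mono[OF 4, of "2 * (real k + 1)"] by simp
  also have "\<dots> = 4 * (\<Sum>i<d. (y0 i - ystar i)\<^sup>2) - (real k + 1)\<^sup>2 * G"
    by (simp add: power2_eq_square algebra_simps)
  finally have "(real k + 1)\<^sup>2 * G \<le> 4 * (\<Sum>i<d. (y0 i - ystar i)\<^sup>2)"
    by simp
  then have "G \<le> 4 * (\<Sum>i<d. (y0 i - ystar i)\<^sup>2) / (real k + 1)\<^sup>2"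
    by (simp add: pos_le_divide_eq mult.commute)
  then show ?thesis
    by (simp add: eucl_dist_power2 G_def g_def y_def)
qed

lemma anytime_optimal_halpern_coeff: "anytime_optimal halpern_coeff"
  unfolding anytime_optimal_def optimal_at_def iterates_halpern_coeff using OHM_rate by blast

section \<open>Optimality forces uniform coefficients\<close>

text \<open>Plays the formal variable z: \<open>iterates\<close> makes sense for any operator on
  sequences, so running it on this one produces the polynomials themselves, and identities of
  iterates that hold for all operators specialize to polynomial identities.\<close>

definition shift :: "(nat \<Rightarrow> real) \<Rightarrow> nat \<Rightarrow> real" where
  "shift x = (\<lambda>i. if i = 0 then 0 else x (i - 1))"

text \<open>\<open>iter_coeff h k i\<close> is the coefficient of \<open>z\<^sup>i\<close> in \<open>p\<^sub>k\<close>: multiplication by \<open>z\<close> shifts coefficients.\<close>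

definition iter_coeff :: "(nat \<Rightarrow> nat \<Rightarrow> real) \<Rightarrow> nat \<Rightarrow> nat \<Rightarrow> real" where
  "iter_coeff h k = iterates h shift (\<lambda>i. if i = 0 then 1 else 0) k"

lemma iter_coeff_0: "iter_coeff h 0 = (\<lambda>i. if i = 0 then 1 else 0)"
  by (simp add: iter_coeff_def)

lemma iter_coeff_Suc:
  "iter_coeff h (Suc k) i = iter_coeff h k i
     - (\<Sum>j\<le>k. h (k + 1) (j + 1) * (iter_coeff h j i - shift (iter_coeff h j) i))"
  by (simp add: iter_coeff_def)

text \<open>Telescoping. Partial sums thus invert multiplication by 1 - z, which is why they
  describe the iterates of the negacyclic shift below.\<close>

lemma sum_minus_shift: "(\<Sum>i\<le>m. x i - shift x i) = x m"
  by (induction m) (simp_all add: shift_def)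

text \<open>The degree bound: a step only adds multiples of \<open>(1 - z) p\<^sub>j\<close> with
  \<open>j\<close> up to the old index.\<close>

lemma iter_coeff_eq_0: "k < i \<Longrightarrow> iter_coeff h k i = 0"
proof (induction k arbitrary: i rule: less_induct)
  case (less k)
  show ?case
  proof (cases k)
    case 0
    then show ?thesis using less.prems by (simp add: iter_coeff_0)
  next
    case (Suc m)
    have "iter_coeff h j i = 0" "shift (iter_coeff h j) i = 0" if "j \<le> m" for j
      using that Suc less.prems less.IH[of j] by (auto simp: shift_def)
    then show ?thesis using Suc by (simp add: iter_coeff_Suc)
  qed
qed

lemma sum_iter_coeff_Suc:
  "(\<Sum>i\<le>m. iter_coeff h (Suc k) i) = (\<Sum>i\<le>m. iter_coeff h k i)
     - (\<Sum>j\<le>k. h (k + 1) (j + 1) * iter_coeff h j m)"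
proof -
  have "(\<Sum>i\<le>m. \<Sum>j\<le>k. h (k + 1) (j + 1) * (iter_coeff h j i - shift (iter_coeff h j) i))
      = (\<Sum>j\<le>k. h (k + 1) (j + 1) * (\<Sum>i\<le>m. iter_coeff h j i - shift (iter_coeff h j) i))"
    by (subst sum.swap) (simp only: sum_distrib_left)
  then show ?thesis
    by (simp only: iter_coeff_Suc sum_subtractf[of "iter_coeff h k"] sum_minus_shift)
qed

text \<open>The normalization \<open>p\<^sub>k(1) = 1\<close>: every correction carries the factor 1
  - z.\<close>

lemma sum_iter_coeff: "k \<le> m \<Longrightarrow> (\<Sum>i\<le>m. iter_coeff h k i) = 1"
proof (induction k)
  case 0
  show ?case by (simp add: iter_coeff_0)
next
  case (Suc k)
  then show ?case by (simp add: sum_iter_coeff_Suc iter_coeff_eq_0)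
qed

text \<open>The dimension is \<open>k + 1\<close>.\<close>

definition negacyclic_shift :: "nat \<Rightarrow> (nat \<Rightarrow> real) \<Rightarrow> nat \<Rightarrow> real" where
  "negacyclic_shift k x = (\<lambda>m. if m = 0 then - x k else if m \<le> k then x (m - 1) else 0)"

text \<open>A signed permutation of the coordinates is an isometry.\<close>

lemma nonexpansive_negacyclic_shift: "nonexpansive (Suc k) (negacyclic_shift k)"
proof -
  have "eucl_dist (Suc k) (negacyclic_shift k x) (negacyclic_shift k y) = eucl_dist (Suc k) x y" for x y
  proof -
    have "(\<Sum>i<Suc k. (negacyclic_shift k x i - negacyclic_shift k y i)\<^sup>2)
        = (- x k - - y k)\<^sup>2 + (\<Sum>i<k. (x i - y i)\<^sup>2)"
      unfolding sum.lessThan_Suc_shift by (simp add: negacyclic_shift_def)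
    also have "\<dots> = (\<Sum>i<Suc k. (x i - y i)\<^sup>2)"
      by (simp add: power2_eq_square algebra_simps)
    finally show ?thesis by (simp add: eucl_dist_def L2_set_def)
  qed
  then show ?thesis
    by (auto simp: nonexpansive_def topspace_Euclidean_space negacyclic_shift_def)
qed

text \<open>Consecutive partial sums differ by one coefficient. At index 0 the sign of the
  wrap-around adds the last entry, which is 2 * 1 - 1 = 1 because the coefficients sum to 1, and
  this cancels the offset -1.\<close>

lemma residual_negacyclic_shift:
  assumes "j \<le> k" and "m \<le> k"
    and "\<And>m. m \<le> k \<Longrightarrow> y m = 2 * (\<Sum>i\<le>m. iter_coeff h j i) - 1"
  shows "y m - negacyclic_shift k y m = 2 * iter_coeff h j m"
proof (cases m)
  case 0
  then show ?thesis
    using assms sum_iter_coeff[OF assms(1), of h] by (simp add: negacyclic_shift_def)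
next
  case (Suc l)
  then show ?thesis using assms by (simp add: negacyclic_shift_def)
qed

lemma iterates_negacyclic_shift:
  fixes k
  defines "u \<equiv> \<lambda>m. if m \<le> k then 1 else (0 :: real)"
  assumes "j \<le> k" and "m \<le> k"
  shows "iterates h (negacyclic_shift k) u j m = 2 * (\<Sum>i\<le>m. iter_coeff h j i) - 1"
  using assms(2,3)
proof (induction j arbitrary: m rule: less_induct)
  case (less j)
  show ?case
  proof (cases j)
    case 0
    then show ?thesis using less.prems by (simp add: u_def iter_coeff_0)
  next
    case (Suc l)
    let ?y = "iterates h (negacyclic_shift k) u"
    have "?y i m - negacyclic_shift k (?y i) m = 2 * iter_coeff h i m" if "i \<le> l" for i
      using that less Suc by (intro residual_negacyclic_shift) auto
    then have "?y (Suc l) m = ?y l m - (\<Sum>i\<le>l. h (l + 1) (i + 1) * (2 * iter_coeff h i m))"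
      by simp
    also have "\<dots> = 2 * (\<Sum>i\<le>m. iter_coeff h l i) - 1 - 2 * (\<Sum>i\<le>l. h (l + 1) (i + 1) * iter_coeff h i m)"
      using less.IH[of l m] less.prems Suc by (simp add: sum_distrib_left mult.left_commute)
    also have "\<dots> = 2 * (\<Sum>i\<le>m. iter_coeff h (Suc l) i) - 1"
      by (simp add: sum_iter_coeff_Suc)
    finally show ?thesis using Suc by simp
  qed
qed

text \<open>Optimality is tested on the negacyclic shift with fixed point 0 and the all-ones start,
  whose squared norm is \<open>k + 1\<close>.\<close>

lemma sum_power2_iter_coeff_le:
  assumes "optimal_at h k"
  shows "(\<Sum>i\<le>k. (iter_coeff h k i)\<^sup>2) \<le> 1 / (real k + 1)"
proof -
  define u where "u = (\<lambda>m. if m \<le> k then 1 else (0 :: real))"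
  define z where "z = (\<lambda>m :: nat. 0 :: real)"
  let ?T = "negacyclic_shift k"
  let ?y = "iterates h ?T u k"
  have le: "(eucl_dist (Suc k) ?y (?T ?y))\<^sup>2 \<le> 4 * (eucl_dist (Suc k) u z)\<^sup>2 / (real k + 1)\<^sup>2"
  proof -
    have "z \<in> topspace (Euclidean_space (Suc k))" "u \<in> topspace (Euclidean_space (Suc k))" "?T z = z"
      by (auto simp: topspace_Euclidean_space z_def u_def negacyclic_shift_def)
    then show ?thesis
      using assms nonexpansive_negacyclic_shift[of k] unfolding optimal_at_def by auto
  qed
  have u: "(eucl_dist (Suc k) u z)\<^sup>2 = real k + 1"
    by (simp add: eucl_dist_power2 u_def z_def lessThan_Suc_atMost)
  have "(eucl_dist (Suc k) ?y (?T ?y))\<^sup>2 = (\<Sum>i\<le>k. (2 * iter_coeff h k i)\<^sup>2)"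
    unfolding eucl_dist_power2 lessThan_Suc_atMost u_def
    by (intro sum.cong refl arg_cong[where f = "\<lambda>x. x\<^sup>2"] residual_negacyclic_shift
        iterates_negacyclic_shift) auto
  also have "\<dots> = 4 * (\<Sum>i\<le>k. (iter_coeff h k i)\<^sup>2)"
    by (simp add: power_mult_distrib sum_distrib_left)
  finally have "4 * (\<Sum>i\<le>k. (iter_coeff h k i)\<^sup>2) \<le> 4 * ((real k + 1) / (real k + 1)\<^sup>2)"
    using le unfolding u by simp
  also have "\<dots> = 4 * (1 / (real k + 1))"
    by (simp add: power2_eq_square)
  finally show ?thesis by simp
qed

text \<open>The equality case of Cauchy-Schwarz: the squared deviations of the \<open>k + 1\<close>
  coefficients from their mean \<open>1 / (k + 1)\<close> have a nonpositive sum.\<close>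

lemma iter_coeff_uniform:
  assumes "optimal_at h k"
  shows "iter_coeff h k i = (if i \<le> k then 1 / (real k + 1) else 0)"
proof -
  let ?b = "iter_coeff h k" and ?n = "real k + 1"
  have "(\<Sum>i\<le>k. (?b i - 1 / ?n)\<^sup>2) = (\<Sum>i\<le>k. (?b i)\<^sup>2 - 2 / ?n * ?b i + (1 / ?n)\<^sup>2)"
    by (intro sum.cong refl) (simp add: power2_diff)
  also have "\<dots> = (\<Sum>i\<le>k. (?b i)\<^sup>2) - 2 / ?n * (\<Sum>i\<le>k. ?b i) + ?n * (1 / ?n)\<^sup>2"
    by (simp add: sum.distrib sum_subtractf sum_distrib_left add.commute)
  also have "\<dots> = (\<Sum>i\<le>k. (?b i)\<^sup>2) - 1 / ?n"
    by (simp add: sum_iter_coeff power2_eq_square)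
  also have "\<dots> \<le> 0"
    using sum_power2_iter_coeff_le[OF assms] by simp
  finally have "(\<Sum>i\<le>k. (?b i - 1 / ?n)\<^sup>2) = 0"
    by (meson antisym sum_nonneg zero_le_power2)
  then have "\<forall>i\<le>k. ?b i = 1 / ?n"
    by (subst (asm) sum_nonneg_eq_0_iff) auto
  then show ?thesis
    by (simp add: iter_coeff_eq_0)
qed

section \<open>Recovering the step coefficients\<close>

lemma iter_coeff_leading:
  "iter_coeff h (Suc k) (Suc k) = h (k + 1) (k + 1) * iter_coeff h k k"
proof -
  have "(\<Sum>j\<le>k. h (k + 1) (j + 1) * (iter_coeff h j (Suc k) - shift (iter_coeff h j) (Suc k)))
      = (\<Sum>j\<le>k. if j = k then - (h (k + 1) (k + 1) * iter_coeff h k k) else 0)"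
    by (intro sum.cong refl) (auto simp: iter_coeff_eq_0 shift_def)
  then show ?thesis by (simp add: iter_coeff_Suc iter_coeff_eq_0)
qed

text \<open>The leading coefficient of \<open>p\<^sub>k\<close> is the product of the diagonal step
  coefficients, so optimality at the single index \<open>k\<close> also controls the degrees of all
  earlier polynomials.\<close>

lemma iter_coeff_leading_nonzero:
  assumes "iter_coeff h k k \<noteq> 0" and "j \<le> k"
  shows "iter_coeff h j j \<noteq> 0"
  using assms(2,1) by (induction rule: dec_induct) (auto simp: iter_coeff_leading)

text \<open>The polynomials \<open>(1 - z) p\<^sub>j\<close> have exact degree \<open>j + 1\<close>,
  hence form a triangular system; the induction reads off the coefficient of top degree.\<close>

lemma iter_coeff_residual_independent:
  assumes "iter_coeff h k k \<noteq> 0"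
    and "\<And>i. (\<Sum>j\<le>k. c j * (iter_coeff h j i - shift (iter_coeff h j) i)) = 0"
    and "j \<le> k"
  shows "c j = 0"
  using assms
proof (induction k)
  case 0
  from "0.prems"(1,3) "0.prems"(2)[of 1] show ?case
    by (simp add: shift_def iter_coeff_0)
next
  case (Suc k)
  let ?v = "\<lambda>j i. iter_coeff h j i - shift (iter_coeff h j) i"
  have "?v j (Suc (Suc k)) = 0" if "j \<le> k" for j
    using that by (simp add: shift_def iter_coeff_eq_0)
  then have "(\<Sum>j\<le>k. c j * ?v j (Suc (Suc k))) = 0"
    by simp
  then have "c (Suc k) * ?v (Suc k) (Suc (Suc k)) = 0"
    using Suc.prems(2)[of "Suc (Suc k)"] by simp
  then have top: "c (Suc k) = 0"
    using Suc.prems(1) by (simp add: shift_def iter_coeff_eq_0)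
  have "c j = 0" if "j \<le> k"
    using Suc.prems top that iter_coeff_leading_nonzero[OF Suc.prems(1), of k]
    by (intro Suc.IH) auto
  then show ?case using top Suc.prems(3) le_Suc_eq by auto
qed

lemma iter_coeff_leading_nonzero_if_optimal: "optimal_at h k \<Longrightarrow> iter_coeff h k k \<noteq> 0"
  by (simp add: iter_coeff_uniform add_nonneg_eq_0_iff)

text \<open>Both methods generate the same uniform polynomials, so subtracting their recursions
  leaves a vanishing combination of independent residuals.\<close>

lemma anytime_optimal_unique:
  assumes "anytime_optimal h" and "anytime_optimal h'" and "j \<le> k"
  shows "h (k + 1) (j + 1) = h' (k + 1) (j + 1)"
proof -
  have opt: "optimal_at h k" "optimal_at h' k" for k
    using assms(1,2) by (auto simp: anytime_optimal_def)
  then have same: "iter_coeff h' k = iter_coeff h k" for k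
    by (simp add: iter_coeff_uniform fun_eq_iff)
  define c where "c = (\<lambda>j. h (k + 1) (j + 1) - h' (k + 1) (j + 1))"
  have "(\<Sum>j\<le>k. c j * (iter_coeff h j i - shift (iter_coeff h j) i)) = 0" for i
    using iter_coeff_Suc[of h k i] iter_coeff_Suc[of h' k i]
    by (simp add: same c_def left_diff_distrib sum_subtractf)
  then have "c j = 0"
    using iter_coeff_residual_independent[OF iter_coeff_leading_nonzero_if_optimal[OF opt(1)]] assms(3)
    by blast
  then show ?thesis by (simp add: c_def)
qed

text \<open>The coefficients are chosen before \<open>T\<close> and \<open>y0\<close>, so that they
  can be determined on \<open>shift\<close> and then used for every operator.\<close>

lemma iterates_minus_start:
  "\<exists>a. \<forall>T y0 i. iterates h T y0 k i - y0 i
     = - (\<Sum>j<k. a j * (iterates h T y0 j i - T (iterates h T y0 j) i))"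
proof (induction k)
  case 0
  show ?case by simp
next
  case (Suc k)
  then obtain a where a: "iterates h T y0 k i - y0 i
     = - (\<Sum>j<k. a j * (iterates h T y0 j i - T (iterates h T y0 j) i))" for T y0 i
    by blast
  define a' where "a' j = (if j < k then a j else 0) + h (k + 1) (j + 1)" for j
  have "iterates h T y0 (Suc k) i - y0 i
     = - (\<Sum>j<Suc k. a' j * (iterates h T y0 j i - T (iterates h T y0 j) i))" for T y0 i
    using a[of T y0 i]
    by (simp add: a'_def distrib_right sum.distrib lessThan_Suc_atMost[symmetric])
  then show ?case by blast
qed

lemma halpern_step_as_residual_sum:
  "\<exists>c. \<forall>T y0 i. halpern_step T y0 k (iterates h T y0 k) i = iterates h T y0 k i
     - (\<Sum>j\<le>k. c j * (iterates h T y0 j i - T (iterates h T y0 j) i))"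
proof -
  obtain a where a: "iterates h T y0 k i - y0 i
     = - (\<Sum>j<k. a j * (iterates h T y0 j i - T (iterates h T y0 j) i))" for T y0 i
    using iterates_minus_start by blast
  \<comment> \<open>The step moves \<open>y k\<close> by -((y k - y0) + (k + 1) * g k) / (k + 2),
    where g k is the residual and y k - y0 is expanded with the coefficients
    \<open>a\<close>.\<close>
  define c where "c j = (if j < k then - a j / (real k + 2) else (real k + 1) / (real k + 2))" for j
  have "halpern_step T y0 k (iterates h T y0 k) i = iterates h T y0 k i
     - (\<Sum>j\<le>k. c j * (iterates h T y0 j i - T (iterates h T y0 j) i))" for T y0 i
  proof -
    let ?y = "iterates h T y0"
    have "(\<Sum>j<k. c j * (?y j i - T (?y j) i))
        = (1 / (real k + 2)) * - (\<Sum>j<k. a j * (?y j i - T (?y j) i))"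
      unfolding sum_distrib_left sum_negf[symmetric] by (intro sum.cong refl) (simp add: c_def)
    also have "\<dots> = (?y k i - y0 i) / (real k + 2)"
      by (simp only: a[symmetric]) simp
    finally have sum: "(\<Sum>j\<le>k. c j * (?y j i - T (?y j) i))
        = (?y k i - y0 i) / (real k + 2) + (real k + 1) / (real k + 2) * (?y k i - T (?y k) i)"
      by (simp add: lessThan_Suc_atMost[symmetric]) (simp add: c_def)
    have "real k + 2 \<noteq> 0"
      by linarith
    then have "(real k + 2) * (\<Sum>j\<le>k. c j * (?y j i - T (?y j) i))
        = (?y k i - y0 i) + (real k + 1) * (?y k i - T (?y k) i)"
      unfolding sum distrib_left by simp
    then have "(real k + 2) * (?y k i - (\<Sum>j\<le>k. c j * (?y j i - T (?y j) i)))
        = y0 i + (real k + 1) * T (?y k) i"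
      unfolding right_diff_distrib[of "real k + 2" "?y k i"] by (simp add: algebra_simps)
    then show ?thesis
      by (simp only: halpern_step_eq_iff[symmetric])
  qed
  then show ?thesis by blast
qed

text \<open>The actual step and the Halpern step are both combinations of the same residuals. They
  agree on \<open>shift\<close>, independence makes their coefficients equal, and so they agree for
  every \<open>T\<close>.\<close>

lemma iterates_Suc_eq_halpern_step:
  assumes "optimal_at h k" and "optimal_at h (Suc k)"
  shows "iterates h T y0 (Suc k) = halpern_step T y0 k (iterates h T y0 k)"
proof -
  obtain c where c: "halpern_step T y0 k (iterates h T y0 k) i = iterates h T y0 k i
     - (\<Sum>j\<le>k. c j * (iterates h T y0 j i - T (iterates h T y0 j) i))" for T y0 i
    using halpern_step_as_residual_sum by blast
  let ?e = "\<lambda>i :: nat. if i = 0 then 1 else (0 :: real)"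
  \<comment> \<open>In polynomials: (1 + z (1 + ... + z^k)) / (k + 2) is again uniform, of degree k
    + 1.\<close>
  have "halpern_step shift ?e k (iter_coeff h k) i = iter_coeff h (Suc k) i" for i
    by (cases i) (simp_all add: iter_coeff_uniform[OF assms(1)] iter_coeff_uniform[OF assms(2)]
        halpern_step_def shift_def add.commute)
  then have eq: "(\<Sum>j\<le>k. c j * (iter_coeff h j i - shift (iter_coeff h j) i))
      = (\<Sum>j\<le>k. h (k + 1) (j + 1) * (iter_coeff h j i - shift (iter_coeff h j) i))" for i
    using c[of shift ?e i] iter_coeff_Suc[of h k i] unfolding iter_coeff_def[symmetric] by simp
  have "h (k + 1) (j + 1) - c j = 0" if "j \<le> k" for j
    by (rule iter_coeff_residual_independent[OF iter_coeff_leading_nonzero_if_optimal[OF assms(1)] _ that,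
          of "\<lambda>j. h (k + 1) (j + 1) - c j"])
      (use eq in \<open>simp add: left_diff_distrib sum_subtractf\<close>)
  then have "c j = h (k + 1) (j + 1)" if "j \<le> k" for j
    using that by simp
  then show ?thesis
    by (intro ext) (simp add: c)
qed

theorem corollary2:
  shows "(\<exists>hO :: nat \<Rightarrow> nat \<Rightarrow> real.
            (\<forall>d\<ge>1. \<forall>T. nonexpansive d T \<longrightarrow>
               (\<forall>y0\<in>topspace (Euclidean_space d). \<forall>k. iterates hO T y0 k = OHM T y0 k)) \<and>
            anytime_optimal hO \<and>
            (\<forall>h. anytime_optimal h \<longrightarrow>
               (\<forall>k. \<forall>j\<le>k. h (k + 1) (j + 1) = hO (k + 1) (j + 1)))) \<and>
         (\<forall>N\<ge>1. \<forall>h :: nat \<Rightarrow> nat \<Rightarrow> real. anytime_beyond_optimal N h \<longrightarrow>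
            (\<forall>d\<ge>1. \<forall>T. nonexpansive d T \<longrightarrow>
               (\<forall>y0\<in>topspace (Euclidean_space d). \<forall>k\<ge>N - 1.
                  iterates h T y0 (k + 1) = halpern_step T y0 k (iterates h T y0 k))))"
proof (intro conjI exI[of _ halpern_coeff] allI impI ballI)
  fix T y0 k
  show "iterates halpern_coeff T y0 k = OHM T y0 k"
    by (rule iterates_halpern_coeff)
next
  show "anytime_optimal halpern_coeff"
    by (rule anytime_optimal_halpern_coeff)
next
  fix h and k j :: nat
  assume "anytime_optimal h" and "j \<le> k"
  then show "h (k + 1) (j + 1) = halpern_coeff (k + 1) (j + 1)"
    using anytime_optimal_halpern_coeff anytime_optimal_unique by blast
next
  fix N h T y0 and k :: nat
  assume "anytime_beyond_optimal N h" and "N - 1 \<le> k"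
  then have "optimal_at h k" "optimal_at h (Suc k)"
    by (auto simp: anytime_beyond_optimal_def)
  then show "iterates h T y0 (k + 1) = halpern_step T y0 k (iterates h T y0 k)"
    using iterates_Suc_eq_halpern_step by simp
qed

end
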